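(* Let $f \in \mathbb{Z}[x]$ be a square-free polynomial of degree $n$, and let $A, B \in \mathcal{M}_f$, i.e. $A$ and $B$ are $n \times n$ integer matrices with $\det(xI-A)=\det(xI-B)=f$. Then for every prime $p$ which does not divide the discriminant $\mathrm{disc}(f)$, the matrices $A$ and $B$ are in the same $\mathrm{GL}_n(\mathbb{Z}_p)$-conjugacy class, i.e. there exists $C \in \mathrm{GL}_n(\mathbb{Z}_p)$ with $C^{-1}AC=B$.
   Context: For a square-free $f \in \mathbb{Z}[x]$ of degree $n$, $\mathcal{M}_f=\{A \in \mathbb{Z}^{n\times n} : \det(xI-A)=f\}$ (so if $\mathcal{M}_f$ is non-empty, $f$ is monic). $\mathbb{Z}_p$ denotes the ring of $p$-adic integers, and integer matrices are regarded as matrices over $\mathbb{Z}_p$ via $\mathbb{Z}\subset\mathbb{Z}_p$. For a commutative ring $R$, $\mathrm{GL}_n(R)$ is the group of $n\times n$ matrices over $R$ whose determinant is a unit of $R$; matrices $A,B\in R^{n\times n}$ are $\mathrm{GL}_n(R)$-conjugate if there is $C\in \mathrm{GL}_n(R)$ with $C^{-1}AC=B$. *)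

theory Defs
  imports
    "HOL-Computational_Algebra.Squarefree"
    "HOL-Algebra.IntRing"
    "Jordan_Normal_Form.Char_Poly"
    "Subresultants.Resultant_Prelim"
begin

section \<open>Integer matrices with given characteristic polynomial\<close>

definition M_set :: "int poly \<Rightarrow> int mat set" where
  "M_set f = {A \<in> carrier_mat (degree f) (degree f). char_poly A = f}"

text \<open>
  The usual formula \<open>disc(f) = (-1)^(n(n-1)/2) Res(f, f') / lc(f)\<close>. For \<open>n > 0\<close> the division
  is exact, since the leading coefficient divides the first column of the Sylvester matrix;
  \<open>disc 1 = 1\<close>.
\<close>

definition disc :: "int poly \<Rightarrow> int" where
  "disc f = (-1) ^ (degree f * (degree f - 1) div 2) * (resultant f (pderiv f) div lead_coeff f)"

section \<open>Square matrices over a commutative ring given by a carrier\<close>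

text \<open>
  The type \<open>'a mat\<close> serves only as a container here: its own product and determinant
  refer to the ring operations of the type, whereas the following refer to a ring \<open>R\<close>
  with carrier a subset of the type.
\<close>

definition mat_monoid :: "('a, 'b) ring_scheme \<Rightarrow> nat \<Rightarrow> 'a mat monoid" where
  "mat_monoid R n =
     \<lparr>carrier = {A \<in> carrier_mat n n. \<forall>i<n. \<forall>j<n. A $$ (i, j) \<in> carrier R},
      mult = (\<lambda>A B. mat n n (\<lambda>(i, j). \<Oplus>\<^bsub>R\<^esub>k\<in>{0..<n}. A $$ (i, k) \<otimes>\<^bsub>R\<^esub> B $$ (k, j))),
      one = mat n n (\<lambda>(i, j). if i = j then \<one>\<^bsub>R\<^esub> else \<zero>\<^bsub>R\<^esub>)\<rparr>"

definition ring_det :: "('a, 'b) ring_scheme \<Rightarrow> nat \<Rightarrow> 'a mat \<Rightarrow> 'a" where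
  "ring_det R n A =
     (\<Oplus>\<^bsub>R\<^esub>\<pi>\<in>{\<pi>. \<pi> permutes {0..<n}}.
        (if evenperm \<pi> then \<one>\<^bsub>R\<^esub> else \<ominus>\<^bsub>R\<^esub> \<one>\<^bsub>R\<^esub>) \<otimes>\<^bsub>R\<^esub> (\<Otimes>\<^bsub>R\<^esub>i\<in>{0..<n}. A $$ (i, \<pi> i)))"

definition GL :: "('a, 'b) ring_scheme \<Rightarrow> nat \<Rightarrow> 'a mat set" where
  "GL R n = {A \<in> carrier (mat_monoid R n). ring_det R n A \<in> Units R}"

definition GL_conjugate :: "('a, 'b) ring_scheme \<Rightarrow> nat \<Rightarrow> 'a mat \<Rightarrow> 'a mat \<Rightarrow> bool" where
  "GL_conjugate R n A B \<longleftrightarrow>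
     (\<exists>C\<in>GL R n. inv\<^bsub>mat_monoid R n\<^esub> C \<otimes>\<^bsub>mat_monoid R n\<^esub> A \<otimes>\<^bsub>mat_monoid R n\<^esub> C = B)"

section \<open>The ring of p-adic integers\<close>

text \<open>
  The inverse limit of the rings \<open>\<int>/p^k\<int>\<close>: the \<open>k\<close>-th entry of a sequence is the least
  non-negative representative of a residue class modulo \<open>p^k\<close>.
\<close>

definition padic_int :: "nat \<Rightarrow> (nat \<Rightarrow> int) ring" where
  "padic_int p =
     \<lparr>carrier = {x. \<forall>k. x k \<in> {0..<int p ^ k} \<and> x (Suc k) mod int p ^ k = x k},
      mult = (\<lambda>x y k. x k * y k mod int p ^ k),
      one = (\<lambda>k. 1 mod int p ^ k),
      zero = (\<lambda>k. 0),
      add = (\<lambda>x y k. (x k + y k) mod int p ^ k)\<rparr>"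

definition padic_of_int :: "nat \<Rightarrow> int \<Rightarrow> nat \<Rightarrow> int" where
  "padic_of_int p a = (\<lambda>k. a mod int p ^ k)"

lemma padic_of_int_closed:
  assumes "p > 0"
  shows "padic_of_int p a \<in> carrier (padic_int p)"
  using assms by (auto simp: padic_of_int_def padic_int_def mod_mod_cancel)

lemma padic_int_cring:
  assumes p: "p > 0"
  shows "cring (padic_int p)"
proof -
  have coh: "f (x (Suc k)) (y (Suc k)) mod int p ^ Suc k mod int p ^ k = f (x k) (y k) mod int p ^ k"
    if "x (Suc k) mod int p ^ k = x k" "y (Suc k) mod int p ^ k = y k"
      and "f = (+) \<or> f = (*)" for f x y k
    using that(3) by (auto simp: mod_mod_cancel mod_add_eq mod_mult_eq
        simp flip: that(1,2))
  have "abelian_group (padic_int p)"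
  proof (rule abelian_groupI)
    fix x assume x: "x \<in> carrier (padic_int p)"
    have "(- x (Suc k)) mod int p ^ Suc k mod int p ^ k = (- x k) mod int p ^ k" for k
      using x by (simp add: padic_int_def mod_mod_cancel) (metis mod_minus_eq)
    then have "(\<lambda>k. (- x k) mod int p ^ k) \<in> carrier (padic_int p)"
      using p by (auto simp: padic_int_def)
    then show "\<exists>y\<in>carrier (padic_int p). y \<oplus>\<^bsub>padic_int p\<^esub> x = \<zero>\<^bsub>padic_int p\<^esub>"
      by (rule rev_bexI) (simp add: padic_int_def mod_add_left_eq)
  qed (use p coh[where f = "(+)"] in
      \<open>auto simp: padic_int_def mod_simps algebra_simps\<close>)
  moreover have "comm_monoid (padic_int p)"
    by (rule comm_monoidI)
      (use p coh[where f = "(*)"] in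
        \<open>auto simp: padic_int_def mod_simps algebra_simps mod_mod_cancel\<close>)
  ultimately show ?thesis
    by (rule cringI) (auto simp: padic_int_def mod_simps algebra_simps)
qed

lemma padic_of_int_hom:
  assumes "p > 0"
  shows "padic_of_int p \<in> Ring.ring_hom \<Z> (padic_int p)"
  using padic_of_int_closed[OF assms]
  by (intro ring_hom_memI) (auto simp: padic_of_int_def padic_int_def mod_simps)

end

theory Submission
  imports
    Defs
    "HOL-Number_Theory.Cong"
    "HOL-Library.Function_Algebras"
begin

text \<open>
  If \<open>v\<close> is an integer vector that is cyclic for \<open>A\<close> modulo \<open>p\<close>, then the integer matrix
  \<open>P = (v, A v, \<dots>, A^(n-1) v)\<close> has determinant prime to \<open>p\<close> and \<open>A P = P C\<close> for the companion
  matrix \<open>C\<close> of \<open>f\<close>. With \<open>Q\<close> likewise for \<open>B\<close>, the integer matrix \<open>X = P adj(Q)\<close> satisfies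
  \<open>A X = X B\<close> and \<open>p\<close> does not divide \<open>det X\<close>, so \<open>X\<close> conjugates over \<open>\<int>\<^sub>p\<close>.

  A cyclic vector modulo \<open>p\<close> is found by enlarging annihilators. Let \<open>m\<close> generate the annihilator
  of \<open>v\<close> modulo \<open>p\<close> and \<open>f = m h\<close> with \<open>deg m < n\<close>. As \<open>p\<close> does not divide the discriminant,
  \<open>m\<close> and \<open>h\<close> are coprime modulo \<open>p\<close>. If \<open>m(A)\<close> vanished modulo \<open>p\<close>, taking determinants in
  \<open>m(x) I = (x I - A) Q(x)\<close> would give that \<open>f\<close> divides \<open>m^n\<close>, contradicting coprimality. So \<open>u = m(A) w\<close> is
  non-zero modulo \<open>p\<close> for some \<open>w\<close>; it is killed by \<open>h\<close>, and \<open>v + u\<close> has a strictly smaller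
  annihilator than \<open>v\<close>.
\<close>

section \<open>Polynomials and modules modulo a prime\<close>

text \<open>Normalises a non-zero polynomial over the field with p elements, while keeping
  everything as integer polynomials.\<close>

lemma monic_multiple_mod_prime:
  fixes g :: "int poly"
  assumes "prime p" and "\<not> [:int p:] dvd g"
  obtains c h where "lead_coeff h = 1" "degree h \<le> degree g" "[:int p:] dvd Polynomial.smult c g - h"
proof -
  \<comment> \<open>Reduction removes top coefficients divisible by \<open>p\<close>, so the leading
    coefficient of \<open>r\<close> is a unit modulo \<open>p\<close>.\<close>
  define r where "r = map_poly (\<lambda>a. a mod int p) g"
  have coeff_r: "coeff r i = coeff g i mod int p" for i
    by (simp add: r_def coeff_map_poly)
  have "r \<noteq> 0"
  proof
    assume "r = 0"
    then have "coeff g i mod int p = 0" for i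
      using coeff_r[of i] by simp
    then show False
      using assms(2) by (simp add: const_poly_dvd_iff mod_eq_0_iff_dvd)
  qed
  then have "lead_coeff r \<noteq> 0"
    by simp
  then have "\<not> int p dvd coeff g (degree r)"
    unfolding coeff_r by (simp add: dvd_eq_mod_eq_0)
  then have "coprime (coeff g (degree r)) (int p)"
    using assms(1) prime_imp_coprime[of "int p" "coeff g (degree r)"] by (simp add: ac_simps)
  then obtain c where c: "[coeff g (degree r) * c = 1] (mod int p)"
    using cong_solve_coprime_int by blast
  \<comment> \<open>\<open>c\<close> inverts the leading coefficient of \<open>r\<close> modulo
    \<open>p\<close>, so the added monomial is divisible by \<open>p\<close>; it makes the top
    coefficient exactly 1.\<close>
  define h where "h = Polynomial.smult c r + monom (1 - c * coeff r (degree r)) (degree r)"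
  have top: "coeff h (degree r) = 1"
    by (simp add: h_def)
  have le: "degree h \<le> degree r"
    unfolding h_def by (intro degree_add_le degree_monom_le) (rule degree_smult_le)
  then have deg: "degree h = degree r"
    using le_degree[of h "degree r"] top by simp
  have "int p dvd coeff (Polynomial.smult c g - h) i" for i
  proof -
    have *: "int p dvd c * coeff g i - c * (coeff g i mod int p)" for i
      by (simp flip: right_diff_distrib)
    have "int p dvd c * coeff g i - 1" if "i = degree r"
      using c that by (simp add: cong_iff_dvd_diff mult.commute)
    then show ?thesis
      using *[of i] by (cases "i = degree r") (simp_all add: top, simp add: h_def coeff_r)
  qed
  moreover have "degree r \<le> degree g"
    unfolding r_def by (rule degree_map_poly_le)
  ultimately show thesis
    using that[of h c] top deg le by (simp add: const_poly_dvd_iff)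
qed

text \<open>Compare degrees modulo \<open>p\<close>: if \<open>z\<close> were non-zero modulo
  \<open>p\<close> it could be made monic, and then its product with \<open>f\<close> has leading
  coefficient 1 in a degree that \<open>g\<close> does not reach.\<close>

lemma prime_dvd_of_monic_dvd_mod:
  fixes f g z :: "int poly"
  assumes p: "prime p" and f: "lead_coeff f = 1" and deg: "degree g < degree f"
    and dvd: "[:int p:] dvd g - f * z"
  shows "[:int p:] dvd g"
proof (cases "[:int p:] dvd z")
  case True
  then have "[:int p:] dvd g - f * z + f * z"
    using dvd by (intro dvd_add) auto
  then show ?thesis
    by simp
next
  case False
  then obtain c h where h: "lead_coeff h = 1" "[:int p:] dvd Polynomial.smult c z - h"
    using monic_multiple_mod_prime[OF p] by metis
  have "Polynomial.smult c g - f * h = Polynomial.smult c (g - f * z) + f * (Polynomial.smult c z - h)"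
    by (simp add: algebra_simps smult_diff_right)
  then have "[:int p:] dvd Polynomial.smult c g - f * h"
    using dvd h(2) by (simp add: dvd_smult)
  then have "int p dvd coeff (Polynomial.smult c g - f * h) (degree f + degree h)"
    by (simp add: const_poly_dvd_iff)
  moreover have "coeff g (degree f + degree h) = 0"
    using deg by (simp add: coeff_eq_0)
  ultimately have "int p dvd 1"
    using f h(1) by (simp add: coeff_mult_degree_sum)
  then show ?thesis
    using p by (simp add: prime_nat_iff)
qed

text \<open>Pseudo-division scales \<open>g\<close> by a power of the leading coefficient of
  \<open>m\<close>, and that power is 1.\<close>

lemma monic_division:
  fixes m g :: "'a::idom poly"
  assumes "lead_coeff m = 1"
  obtains q r where "g = q * m + r" "r = 0 \<or> degree r < degree m"
proof -
  have "m \<noteq> 0"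
    using assms by auto
  obtain q r where qr: "pseudo_divmod g m = (q, r)"
    by fastforce
  then have "g = q * m + r" "r = 0 \<or> degree r < degree m"
    using pseudo_divmod[OF \<open>m \<noteq> 0\<close> qr] assms by (simp_all add: mult.commute)
  then show thesis
    using that by blast
qed

text \<open>The search for a cyclic vector, carried out in the quotient by \<open>N\<close>; by
  \<open>pN\<close> and \<open>fN\<close> this is a module over the polynomials modulo
  \<open>p\<close> and \<open>f\<close>. Membership in \<open>N\<close> avoids forming the quotient.
  \<open>bezout\<close> expresses that \<open>f\<close> is separable modulo
  \<open>p\<close>.\<close>

lemma ex_generator_mod_prime:
  fixes scale :: "int poly \<Rightarrow> 'b::ab_group_add \<Rightarrow> 'b" (infixr \<open>*s\<close> 75)
  assumes "Modules.module scale" and N: "Modules.module.subspace scale N" and p: "prime p" and f: "lead_coeff f = 1"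
    and pN: "\<And>v. [:int p:] *s v \<in> N" and fN: "\<And>v. f *s v \<in> N"
    and bezout: "a * f + b * pderiv f = [:r:]" "\<not> int p dvd r"
    and faithful: "\<And>m. (\<And>w. m *s w \<in> N) \<Longrightarrow> \<exists>k z. [:int p:] dvd m ^ k - f * z"
  shows "\<exists>v. \<forall>g. lead_coeff g = 1 \<longrightarrow> g *s v \<in> N \<longrightarrow> degree f \<le> degree g"
proof -
  interpret Modules.module scale by fact
  define P where "P = [:int p:]"
  have add: "x + y \<in> N" if "x \<in> N" "y \<in> N" for x y
    using N that by (rule subspace_add)
  have diff: "x - y \<in> N" if "x \<in> N" "y \<in> N" for x y
    using N that by (rule subspace_diff)
  have scale: "g *s x \<in> N" if "x \<in> N" for x g
    using N that by (rule subspace_scale)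
  have PN: "g *s v \<in> N" if "P dvd g" for g v
  proof -
    obtain s where "g = P * s"
      using \<open>P dvd g\<close> by blast
    then show ?thesis
      using pN[of "s *s v"] by (simp add: P_def)
  qed
  obtain c where "[r * c = 1] (mod int p)"
    using cong_solve_coprime_int[of r "int p"] bezout(2) p prime_imp_coprime[of "int p" r]
    by (auto simp: ac_simps)
  then have Pc: "P dvd [:c * r - 1:]"
    by (simp add: P_def const_poly_dvd_iff coeff_pCons cong_iff_dvd_diff mult.commute split: nat.split)
  \<comment> \<open>\<open>r\<close> is invertible modulo \<open>p\<close>, so it acts injectively
    on the quotient.\<close>
  have unit: "x \<in> N" if "[:r:] *s x \<in> N" for x
  proof -
    have "x = [:c:] *s [:r:] *s x - [:c * r - 1:] *s x"
      by (simp flip: scale_left_diff_distrib one_pCons)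
    then show ?thesis
      using diff[OF scale[OF that] PN[OF Pc]] by metis
  qed
  have "\<exists>v. \<forall>g. lead_coeff g = 1 \<longrightarrow> g *s v \<in> N \<longrightarrow> d \<le> degree g" if "d \<le> degree f" for d
    using that
  proof (induction d)
    case 0
    then show ?case by simp
  next
    case (Suc d)
    then obtain v where v: "\<And>g. lead_coeff g = 1 \<Longrightarrow> g *s v \<in> N \<Longrightarrow> d \<le> degree g"
      by auto
    show ?case
    proof (cases "\<exists>m. lead_coeff m = 1 \<and> m *s v \<in> N \<and> degree m = d")
      case False
      then have "Suc d \<le> degree g" if "lead_coeff g = 1" "g *s v \<in> N" for g
        using v[OF that] that by (metis Suc_leI le_neq_implies_less)
      then show ?thesis by blast
    next
      case True
      then obtain m where m: "lead_coeff m = 1" "m *s v \<in> N" "degree m = d"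
        by blast
      \<comment> \<open>Otherwise a monic multiple modulo \<open>p\<close> would kill
        \<open>v\<close> in degree below \<open>d\<close>.\<close>
      have low: "P dvd g" if g: "g *s v \<in> N" "degree g < d" for g
      proof (rule ccontr)
        assume "\<not> P dvd g"
        then obtain e h where h: "lead_coeff h = 1" "degree h \<le> degree g" "P dvd Polynomial.smult e g - h"
          using monic_multiple_mod_prime[OF p] unfolding P_def by metis
        have "h *s v = [:e:] *s g *s v - (Polynomial.smult e g - h) *s v"
          by (simp flip: scale_left_diff_distrib)
        then have "h *s v \<in> N"
          using diff[OF scale[OF g(1)] PN[OF h(3)]] by metis
        then show False
          using v[OF h(1)] h(2) g(2) by simp
      qed
      \<comment> \<open>The remainder on division by \<open>m\<close> vanishes modulo
        \<open>p\<close> by \<open>low\<close>, so \<open>m\<close> generates the annihilator of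
        \<open>v\<close> modulo \<open>p\<close>.\<close>
      have gen: "\<exists>q. P dvd g - q * m" if g: "g *s v \<in> N" for g
      proof -
        obtain q s where qs: "g = q * m + s" "s = 0 \<or> degree s < degree m"
          using monic_division[OF m(1)] by blast
        have "s *s v = g *s v - q *s m *s v"
          by (simp add: qs(1) scale_left_distrib)
        then have "s *s v \<in> N"
          using diff[OF g scale[OF m(2)]] by metis
        then have "P dvd s"
          using low qs(2) m(3) by auto
        then show ?thesis
          using qs(1) by (metis add_diff_cancel_left')
      qed
      obtain h s where h: "f = h * m + P * s"
        using gen[OF fN] by (metis dvd_def add.commute diff_add_cancel)
      have "pderiv P = 0"
        by (simp add: P_def)
      \<comment> \<open>Separability makes the two factors of f modulo p coprime.\<close>
      then have "pderiv f = pderiv h * m + h * pderiv m + P * pderiv s"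
        by (simp add: h pderiv_add pderiv_mult algebra_simps)
      then obtain al be t where coprime: "[:r:] = al * m + be * h + P * t"
        using that[of "a * h + b * pderiv h" "b * pderiv m" "a * s + b * pderiv s"] bezout(1)
        unfolding h by (simp add: algebra_simps)
      \<comment> \<open>The Bezout identity is raised to the power \<open>k\<close>; every mixed
        term contains \<open>h\<close> and is collected in \<open>y\<close>.\<close>
      have cop: "\<exists>y t. [:r:] ^ k = al ^ k * m ^ k + y * h + P * t" for k
      proof (induction k)
        case 0
        show ?case
          by (rule exI[of _ 0], rule exI[of _ 0]) simp
      next
        case (Suc k)
        then obtain y t' where "[:r:] ^ k = al ^ k * m ^ k + y * h + P * t'"
          by blast
        then have "[:r:] ^ Suc k = (al * m + be * h + P * t) * (al ^ k * m ^ k + y * h + P * t')"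
          using coprime by simp
        also have "\<dots> = al ^ Suc k * m ^ Suc k
            + (be * (al ^ k * m ^ k + y * h) + al * m * y) * h
            + P * (t * (al ^ k * m ^ k + y * h + P * t') + (al * m + be * h) * t')"
          by (simp add: algebra_simps)
        finally show ?case by blast
      qed
      have "\<exists>w. m *s w \<notin> N"
      proof (rule ccontr)
        assume "\<nexists>w. m *s w \<notin> N"
        then obtain k z where "P dvd m ^ k - f * z"
          using faithful[of m] unfolding P_def by blast
        then obtain t1 where t1: "m ^ k = f * z + P * t1"
          by (metis dvd_def add.commute diff_add_cancel)
        obtain y t2 where t2: "[:r:] ^ k = al ^ k * m ^ k + y * h + P * t2"
          using cop by blast
        \<comment> \<open>Multiplying by \<open>m\<close> turns \<open>y * h\<close> into
          \<open>y * f\<close> modulo \<open>p\<close>. Hence \<open>f\<close> divides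
          \<open>[:r:] ^ k * m\<close> modulo \<open>p\<close>, although the latter has smaller
          degree.\<close>
        have "[:r:] ^ k * m - f * (al ^ k * z * m + y)
            = P * (al ^ k * t1 * m + t2 * m - s * y)"
          unfolding t2 t1 by (simp add: h algebra_simps)
        then have "P dvd [:r:] ^ k * m - f * (al ^ k * z * m + y)"
          by simp
        moreover have "degree ([:r:] ^ k * m) < degree f"
          using m(3) Suc.prems by (simp add: poly_const_pow)
        ultimately have "P dvd [:r:] ^ k * m"
          using prime_dvd_of_monic_dvd_mod[OF p f] unfolding P_def by blast
        then have "int p dvd coeff ([:r:] ^ k * m) (degree m)"
          unfolding P_def const_poly_dvd_iff by blast
        then have "int p dvd r ^ k"
          using m(1) by (simp add: poly_const_pow)
        then show False
          using bezout(2) p prime_dvd_power[of "int p" r k] by simp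
      qed
      then obtain w where w: "m *s w \<notin> N"
        by blast
      define u where "u = m *s w"
      have "h *s u = f *s w - (P * s) *s w"
        unfolding u_def h by (simp add: scale_left_distrib)
      then have hu: "h *s u \<in> N"
        using diff[OF fN PN] by (metis dvd_triv_left)
      \<comment> \<open>A monic \<open>g\<close> of degree at most \<open>d\<close> that kills
        \<open>v + u\<close> also kills \<open>v\<close> and \<open>u\<close> separately, because
        \<open>m\<close> and \<open>h\<close> are coprime modulo \<open>p\<close>. Then
        \<open>g\<close> agrees with \<open>m\<close> modulo \<open>p\<close>, so \<open>u\<close>
        is killed by both \<open>m\<close> and \<open>h\<close> and lies in
        \<open>N\<close>.\<close>
      have "Suc d \<le> degree g" if g: "lead_coeff g = 1" "g *s (v + u) \<in> N" for g
      proof (rule ccontr)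
        assume "\<not> Suc d \<le> degree g"
        then have le: "degree g \<le> d"
          by simp
        have "(g * h) *s v = h *s g *s (v + u) - g *s h *s u"
          by (simp add: scale_right_distrib mult.commute)
        then have "(g * h) *s v \<in> N"
          using diff[OF scale[OF g(2)] scale[OF hu]] by metis
        have "[:r:] * g = al * g * m + be * (g * h) + P * (t * g)"
          unfolding coprime by (simp only: algebra_simps)
        then have "[:r:] *s g *s v = (al * g) *s m *s v + be *s (g * h) *s v + (P * (t * g)) *s v"
          by (simp only: scale_left_distrib scale_scale)
        then have "[:r:] *s g *s v \<in> N"
          using add[OF add[OF scale[OF m(2)] scale[OF \<open>(g * h) *s v \<in> N\<close>]] PN] dvd_triv_left by metis
        then have gv: "g *s v \<in> N"
          by (rule unit)
        then have "degree g = d"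
          using v[OF g(1)] le by simp
        have "g *s u = g *s (v + u) - g *s v"
          by (simp add: scale_right_distrib)
        then have gu: "g *s u \<in> N"
          using diff[OF g(2) gv] by metis
        \<comment> \<open>Both are monic of degree \<open>d\<close>, so their difference has smaller
          degree and \<open>low\<close> applies.\<close>
        have "P dvd g - m"
        proof (cases "g = m")
          case False
          then have "lead_coeff (g - m) \<noteq> 0"
            by (simp del: coeff_diff)
          moreover have "coeff (g - m) d = 0"
            using \<open>degree g = d\<close> m g(1) by simp
          moreover have "degree (g - m) \<le> d"
            using \<open>degree g = d\<close> m by (intro degree_diff_le) simp_all
          ultimately have "degree (g - m) < d"
            by (metis le_neq_implies_less)
          moreover have "(g - m) *s v \<in> N"
            using diff[OF gv m(2)] by (simp add: scale_left_diff_distrib)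
          ultimately show ?thesis
            using low by blast
        qed simp
        have "m *s u = g *s u - (g - m) *s u"
          by (simp flip: scale_left_diff_distrib)
        then have mu: "m *s u \<in> N"
          using diff[OF gu PN[OF \<open>P dvd g - m\<close>]] by metis
        have "[:r:] *s u = al *s m *s u + be *s h *s u + (P * t) *s u"
          unfolding coprime by (simp only: scale_left_distrib scale_scale)
        then have "[:r:] *s u \<in> N"
          using add[OF add[OF scale[OF mu] scale[OF hu]] PN] dvd_triv_left by metis
        then have "u \<in> N"
          by (rule unit)
        then show False
          using w by (simp add: u_def)
      qed
      then show ?thesis
        by blast
    qed
  qed
  then show ?thesis
    by blast
qed

section \<open>Resultants and determinants\<close>

text \<open>The rows of the Sylvester matrix are coefficient vectors of monomial multiples of
  \<open>f\<close> and \<open>g\<close>. Combining them with the last row of the adjugate leaves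
  only the determinant, in the last column, which holds the constant terms.\<close>

lemma resultant_bezout:
  fixes f g :: "'a::comm_ring_1 poly"
  assumes "degree f + degree g > 0"
  shows "\<exists>a b. a * f + b * g = [:resultant f g:]"
proof -
  define m n N where "m = degree f" and "n = degree g" and "N = m + n"
  define S where "S = sylvester_mat f g"
  have S: "S \<in> carrier_mat N N"
    using sylvester_carrier_mat[of f g] by (simp add: S_def N_def m_def n_def)
  have "N > 0"
    using assms by (simp add: N_def m_def n_def)
  define e where "e = (\<lambda>i. adj_mat S $$ (N - 1, i))"
  define u where "u = (\<lambda>i. if i < n then monom 1 (n - 1 - i) else (0 :: 'a poly))"
  define v where "v = (\<lambda>i. if i < n then 0 else (monom 1 (N - 1 - i) :: 'a poly))"
  have coeff_row: "coeff (u i * f + v i * g) k = (if k < N then S $$ (i, N - 1 - k) else 0)"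
    if i: "i < N" for i k
  proof (cases "k < N")
    case True
    then have "S $$ (i, N - 1 - k) =
        (if i < n then coeff (monom 1 (n - i) * f) (N - (N - 1 - k))
         else coeff (monom 1 (N - i) * g) (N - (N - 1 - k)))"
      using sylvester_index_mat2[of i f g "N - 1 - k"] i by (simp add: S_def N_def m_def n_def)
    \<comment> \<open>The entries are described after one extra multiplication by x; the
      \<open>Suc\<close> on both sides cancels this shift.\<close>
    moreover have "N - (N - 1 - k) = Suc k"
      using True by simp
    moreover have "n - i = Suc (n - Suc i)" if "i < n"
      using that by simp
    moreover have "N - i = Suc (N - Suc i)"
      using i by simp
    ultimately show ?thesis
      using \<open>k < N\<close> by (cases "i < n") (simp_all add: u_def v_def coeff_monom_mult)
  next
    case False
    have "coeff f (k - (n - Suc i)) = 0" if "i < n"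
      using False that by (intro coeff_eq_0) (simp add: N_def m_def)
    moreover have "coeff g (k - (N - Suc i)) = 0" if "\<not> i < n"
      using False that i by (intro coeff_eq_0) (simp add: N_def n_def m_def)
    ultimately show ?thesis
      using False by (cases "i < n") (simp_all add: u_def v_def coeff_monom_mult)
  qed
  have last_row: "(\<Sum>i<N. e i * S $$ (i, j)) = (if j = N - 1 then resultant f g else 0)" if "j < N" for j
  proof -
    have "(adj_mat S * S) $$ (N - 1, j) = (\<Sum>i<N. e i * S $$ (i, j))"
      using that adj_mat(1)[OF S] S \<open>N > 0\<close>
      by (simp add: scalar_prod_def e_def lessThan_atLeast0)
    moreover have "resultant f g = det S"
      by (simp add: resultant_def S_def)
    ultimately show ?thesis
      using that \<open>N > 0\<close> by (auto simp: adj_mat(3)[OF S])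
  qed
  have "(\<Sum>i<N. Polynomial.smult (e i) (u i)) * f + (\<Sum>i<N. Polynomial.smult (e i) (v i)) * g
      = (\<Sum>i<N. Polynomial.smult (e i) (u i * f + v i * g))"
    by (simp add: sum_distrib_right smult_add_right sum.distrib)
  also have "\<dots> = [:resultant f g:]"
  proof (rule poly_eqI)
    fix k
    show "coeff (\<Sum>i<N. Polynomial.smult (e i) (u i * f + v i * g)) k = coeff [:resultant f g:] k"
      using last_row[of "N - 1 - k"] \<open>N > 0\<close>
      by (cases "k < N") (auto simp: coeff_sum coeff_row coeff_pCons simp del: coeff_add split: nat.split)
  qed
  finally show ?thesis
    by blast
qed

section \<open>Determinants modulo a divisor\<close>

lemma dvd_prod_diff:
  fixes x y :: "'b \<Rightarrow> 'a::comm_ring_1"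
  assumes "\<And>i. i \<in> S \<Longrightarrow> d dvd x i - y i"
  shows "d dvd prod x S - prod y S"
  using assms
proof (induction S rule: infinite_finite_induct)
  case (insert i S)
  have "prod x (insert i S) - prod y (insert i S)
      = (x i - y i) * prod x S + y i * (prod x S - prod y S)"
    using insert.hyps by (simp add: algebra_simps)
  also have "d dvd \<dots>"
    using insert by (intro dvd_add dvd_mult dvd_mult2) auto
  finally show ?case .
qed simp_all

text \<open>The Leibniz formula is polynomial in the entries. The modulus is later the integer
  \<open>p\<close> as well as the constant polynomial \<open>[:int p:]\<close>.\<close>

lemma dvd_det_diff:
  fixes A B :: "'a::comm_ring_1 mat"
  assumes A: "A \<in> carrier_mat n n" and B: "B \<in> carrier_mat n n"
    and "\<And>i j. i < n \<Longrightarrow> j < n \<Longrightarrow> d dvd A $$ (i, j) - B $$ (i, j)"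
  shows "d dvd det A - det B"
proof -
  have "d dvd (\<Prod>i = 0..<n. A $$ (i, \<pi> i)) - (\<Prod>i = 0..<n. B $$ (i, \<pi> i))"
    if "\<pi> permutes {0..<n}" for \<pi>
    using assms(3) permutes_in_image[OF that] by (intro dvd_prod_diff) auto
  then show ?thesis
    unfolding det_def'[OF A] det_def'[OF B]
    by (auto simp flip: sum_subtractf right_diff_distrib intro!: dvd_sum)
qed

text \<open>Counting residue vectors turns a trivial kernel modulo \<open>p\<close> into a right
  inverse modulo \<open>p\<close>, and determinants are multiplicative.\<close>

lemma prime_not_dvd_det:
  fixes M :: "int mat"
  assumes p: "prime p" and M: "M \<in> carrier_mat n n"
    and kernel: "\<And>c j. (\<And>i. i < n \<Longrightarrow> int p dvd (\<Sum>k<n. M $$ (i, k) * c k)) \<Longrightarrow> j < n \<Longrightarrow> int p dvd c j"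
  shows "\<not> int p dvd det M"
proof
  assume dvd: "int p dvd det M"
  have "int p > 1"
    using p prime_gt_1_nat by simp
  \<comment> \<open>Multiplication by M is injective on the finite set of residue vectors, hence surjective.\<close>
  define V where "V = {..<n} \<rightarrow>\<^sub>E {0..<int p}"
  define \<phi> where "\<phi> = (\<lambda>c. restrict (\<lambda>i. (\<Sum>k<n. M $$ (i, k) * c k) mod int p) {..<n})"
  have "\<phi> ` V = V"
  proof (rule endo_inj_surj)
    show "finite V"
      by (simp add: V_def finite_PiE)
    show "\<phi> ` V \<subseteq> V"
      using \<open>int p > 1\<close> by (intro image_subsetI) (simp add: V_def \<phi>_def restrict_PiE_iff)
    show "inj_on \<phi> V"
    proof (rule inj_onI)
      fix c c' assume c: "c \<in> V" "c' \<in> V" and eq: "\<phi> c = \<phi> c'"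
      have diff: "int p dvd (\<Sum>k<n. M $$ (i, k) * (c k - c' k))" if "i < n" for i
      proof -
        have "(\<Sum>k<n. M $$ (i, k) * c k) mod int p = (\<Sum>k<n. M $$ (i, k) * c' k) mod int p"
          using fun_cong[OF eq, of i] that by (simp add: \<phi>_def)
        then show ?thesis
          by (simp only: mod_eq_dvd_iff right_diff_distrib sum_subtractf)
      qed
      have "int p dvd c j - c' j" if "j < n" for j
        by (rule kernel[of "\<lambda>k. c k - c' k", OF _ that]) (rule diff)
      then have cong: "c j mod int p = c' j mod int p" if "j < n" for j
        using that by (simp only: mod_eq_dvd_iff)
      have "c j = c' j" if "j \<in> {..<n}" for j
      proof -
        have "c j \<in> {0..<int p}" "c' j \<in> {0..<int p}"
          using c that unfolding V_def by (blast dest: PiE_mem)+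
        then show ?thesis
          using cong[of j] that by (simp only: atLeastLessThan_iff lessThan_iff mod_pos_pos_trivial)
      qed
      then show "c = c'"
        by (rule PiE_ext[OF c[unfolded V_def]])
    qed
  qed
  moreover have "restrict (\<lambda>i. if i = l then 1 else 0) {..<n} \<in> V" for l
    using \<open>int p > 1\<close> by (simp add: V_def restrict_PiE_iff)
  ultimately have "\<exists>c. \<phi> c = restrict (\<lambda>i. if i = l then 1 else 0) {..<n}" for l
    by (metis (no_types) imageE)
  then obtain c where c: "\<And>l. \<phi> (c l) = restrict (\<lambda>i. if i = l then 1 else 0) {..<n}"
    by metis
  \<comment> \<open>The columns are preimages of the unit vectors, so \<open>M * Q\<close> is the
    identity modulo \<open>p\<close>.\<close>
  define Q where "Q = mat n n (\<lambda>(i, l). c l i)"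
  have Q: "Q \<in> carrier_mat n n"
    by (simp add: Q_def)
  have "int p dvd (1\<^sub>m n) $$ (i, l) - (M * Q) $$ (i, l)" if "i < n" "l < n" for i l
  proof -
    have "(M * Q) $$ (i, l) = (\<Sum>k<n. M $$ (i, k) * c l k)"
      using M that by (simp add: Q_def scalar_prod_def lessThan_atLeast0)
    also have "\<dots> mod int p = (if i = l then 1 else 0)"
      using fun_cong[OF c, of l i] that by (simp add: \<phi>_def)
    finally have "(M * Q) $$ (i, l) mod int p = (1\<^sub>m n) $$ (i, l) mod int p"
      using that \<open>int p > 1\<close> by simp
    then show ?thesis
      by (simp only: mod_eq_dvd_iff[symmetric])
  qed
  then have "int p dvd det (1\<^sub>m n) - det (M * Q)"
    using M Q by (intro dvd_det_diff[of _ n]) auto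
  then have "int p dvd 1 - det M * det Q"
    using M Q by (simp add: det_mult)
  then have "int p dvd 1"
    using dvd_add[OF _ dvd_mult2[OF dvd, of "det Q"]] by fastforce
  then show False
    using \<open>int p > 1\<close> by simp
qed

section \<open>The cokernel of the characteristic matrix\<close>

text \<open>The cokernel of this map is the lattice of constant vectors with x acting as
  \<open>A\<close>; it replaces explicit powers of \<open>A\<close>. Vectors are functions so that
  they form a module under pointwise operations.\<close>

definition char_op :: "'a::comm_ring_1 mat \<Rightarrow> (nat \<Rightarrow> 'a poly) \<Rightarrow> nat \<Rightarrow> 'a poly" where
  "char_op A q i = (\<Sum>j<dim_row A. char_poly_matrix A $$ (i, j) * q j)"

lemma char_op_diff: "char_op A (\<lambda>j. q j - q' j) i = char_op A q i - char_op A q' i"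
  by (simp add: char_op_def right_diff_distrib sum_subtractf)

lemma char_op_add: "char_op A (\<lambda>j. q j + q' j) i = char_op A q i + char_op A q' i"
  by (simp add: char_op_def distrib_left sum.distrib)

lemma char_op_scale: "char_op A (\<lambda>j. g * q j) i = g * char_op A q i"
  by (simp add: char_op_def sum_distrib_left mult.left_commute)

lemma char_op_sum: "char_op A (\<lambda>j. \<Sum>k\<in>K. q k j) i = (\<Sum>k\<in>K. char_op A (q k) i)"
  by (simp add: char_op_def sum_distrib_left) (rule sum.swap)

lemma char_op_zero [simp]: "char_op A (\<lambda>j. 0) i = 0"
  by (simp add: char_op_def)

lemma char_op_eq:
  assumes A: "A \<in> carrier_mat n n" and i: "i < n"
  shows "char_op A q i = pCons 0 (q i) - (\<Sum>j<n. Polynomial.smult (A $$ (i, j)) (q j))"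
proof -
  have "char_op A q i = (\<Sum>j<n. (if j = i then pCons 0 (q j) else 0) - Polynomial.smult (A $$ (i, j)) (q j))"
    unfolding char_op_def using A i
    by (intro sum.cong) (auto simp: char_poly_matrix_def distrib_right)
  also have "\<dots> = pCons 0 (q i) - (\<Sum>j<n. Polynomial.smult (A $$ (i, j)) (q j))"
    using i by (simp add: sum_subtractf)
  finally show ?thesis .
qed

text \<open>Modulo the image of \<open>char_op\<close>, multiplication by x acts on constants as
  \<open>A\<close>.\<close>

lemma char_op_const:
  assumes "A \<in> carrier_mat n n" "i < n"
  shows "[:0, 1:] * [:c i:] = char_op A (\<lambda>j. [:c j:]) i + [:\<Sum>j<n. A $$ (i, j) * c j:]"
  by (simp add: char_op_eq[OF assms] sum_to_poly[symmetric])

text \<open>Comparing coefficients writes each coefficient vector of \<open>q\<close> as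
  \<open>A\<close> times the next higher one. Those beyond all degrees vanish, hence all do, and
  constants inject into the cokernel.\<close>

lemma char_op_const_unique:
  assumes A: "A \<in> carrier_mat n n" and eq: "\<And>i. i < n \<Longrightarrow> char_op A q i = [:c i:]" and "i < n"
  shows "c i = 0"
proof -
  have step: "coeff (q i) k = (\<Sum>j<n. A $$ (i, j) * coeff (q j) (Suc k))" if "i < n" for i k
    using arg_cong[OF eq[OF that], of "\<lambda>g. coeff g (Suc k)"]
    by (simp add: char_op_eq[OF A that] coeff_sum)
  \<comment> \<open>The sum is a convenient bound above every degree, from which coefficients are
    cleared downwards.\<close>
  define D where "D = (\<Sum>i<n. Suc (degree (q i)))"
  have below: "coeff (q i) (D - k) = 0" if "i < n" for i k
    using that
  proof (induction k arbitrary: i)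
    case 0
    have "Suc (degree (q i)) \<le> D"
      unfolding D_def using 0 by (intro member_le_sum) auto
    then show ?case
      by (simp add: coeff_eq_0)
  next
    case (Suc k)
    show ?case
    proof (cases "k < D")
      case True
      then have "Suc (D - Suc k) = D - k"
        by simp
      then show ?thesis
        using step[OF Suc.prems, of "D - Suc k"] Suc.IH by simp
    next
      case False
      \<comment> \<open>By truncated subtraction both \<open>D - k\<close> and
        \<open>D - Suc k\<close> are 0.\<close>
      then show ?thesis
        using Suc.IH[OF Suc.prems] by simp
    qed
  qed
  have "coeff (q i) k = 0" if "i < n" for i k
  proof (cases "k \<le> D")
    case True
    then show ?thesis
      using below[OF that, of "D - k"] by simp
  next
    case False
    have "Suc (degree (q i)) \<le> D"
      unfolding D_def using that by (intro member_le_sum) auto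
    then show ?thesis
      using False by (simp add: coeff_eq_0)
  qed
  then have "q i = 0" if "i < n" for i
    using that by (simp add: poly_eq_iff)
  then have "char_op A q i = 0"
    using \<open>i < n\<close> by (simp add: char_op_eq[OF A])
  then show ?thesis
    using eq[OF \<open>i < n\<close>] by simp
qed

text \<open>Division with remainder by x I - A: split off the constant terms, reduce the rest by
  induction on the degree, and replace x times its remainder by \<open>A\<close> times it.\<close>

lemma ex_const_mod_char_op:
  assumes A: "A \<in> carrier_mat n n"
  shows "\<exists>q c. \<forall>i<n. w i = char_op A q i + [:c i:]"
proof -
  have "\<exists>q c. \<forall>i<n. w i = char_op A q i + [:c i:]" if "\<forall>i<n. degree (w i) \<le> d" for d w
    using that
  proof (induction d arbitrary: w)
    case 0
    then have "\<forall>i<n. w i = char_op A (\<lambda>j. 0) i + [:coeff (w i) 0:]"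
      by (simp add: degree_0_id)
    then show ?case
      by (intro exI)
  next
    case (Suc d)
    have "\<exists>x g. w i = pCons x g" for i
      by (metis pCons_cases)
    then obtain a b where w: "\<And>i. w i = pCons (a i) (b i)"
      by metis
    have "\<forall>i<n. degree (b i) \<le> d"
      using Suc.prems by (auto simp: w split: if_splits)
    then obtain q c where qc: "\<And>i. i < n \<Longrightarrow> b i = char_op A q i + [:c i:]"
      using Suc.IH[of b] by auto
    have "w i = char_op A (\<lambda>j. [:0, 1:] * q j + [:c j:]) i + [:a i + (\<Sum>j<n. A $$ (i, j) * c j):]"
      if "i < n" for i
    proof -
      have "w i = [:a i:] + [:0, 1:] * b i"
        by (simp add: w)
      also have "\<dots> = [:a i:] + [:0, 1:] * char_op A q i + [:0, 1:] * [:c i:]"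
        using qc[OF that] by (simp only: distrib_left add.assoc)
      finally show ?thesis
        unfolding char_op_const[OF A that] char_op_add char_op_scale by simp
    qed
    then have "\<forall>i<n. w i = char_op A (\<lambda>j. [:0, 1:] * q j + [:c j:]) i
        + [:a i + (\<Sum>j<n. A $$ (i, j) * c j):]"
      by simp
    then show ?case
      by (intro exI)
  qed
  moreover have "\<forall>i<n. degree (w i) \<le> (\<Sum>i<n. degree (w i))"
    by (auto intro: member_le_sum)
  ultimately show ?thesis
    by blast
qed

text \<open>The adjugate supplies explicit preimages showing that the characteristic polynomial
  kills the cokernel; this is the Cayley-Hamilton theorem in the present setting.\<close>

lemma char_op_adj_mat:
  assumes A: "A \<in> carrier_mat n n" and "i < n"
  shows "char_op A (\<lambda>j. \<Sum>k<n. adj_mat (char_poly_matrix A) $$ (j, k) * w k) i = char_poly A * w i"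
proof -
  let ?M = "char_poly_matrix A"
  have M: "?M \<in> carrier_mat n n"
    using A by simp
  have "char_op A (\<lambda>j. \<Sum>k<n. adj_mat ?M $$ (j, k) * w k) i
      = (\<Sum>j<n. \<Sum>k<n. ?M $$ (i, j) * adj_mat ?M $$ (j, k) * w k)"
    using A by (simp add: char_op_def sum_distrib_left mult.assoc)
  also have "\<dots> = (\<Sum>k<n. (\<Sum>j<n. ?M $$ (i, j) * adj_mat ?M $$ (j, k)) * w k)"
    by (subst sum.swap) (simp add: sum_distrib_right)
  also have "\<dots> = (\<Sum>k<n. (?M * adj_mat ?M) $$ (i, k) * w k)"
    using adj_mat(1)[OF M] M \<open>i < n\<close>
    by (intro sum.cong) (simp_all add: scalar_prod_def lessThan_atLeast0)
  also have "\<dots> = (\<Sum>k<n. if k = i then char_poly A * w k else 0)"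
    unfolding adj_mat(2)[OF M] using \<open>i < n\<close> by (intro sum.cong) (auto simp: char_poly_def)
  also have "\<dots> = char_poly A * w i"
    using \<open>i < n\<close> by simp
  finally show ?thesis .
qed

text \<open>For monic \<open>f\<close> of degree \<open>n\<close>, the matrix of multiplication by x
  on 1, ..., x^(n-1) modulo \<open>f\<close>, with images as columns.\<close>

definition companion :: "nat \<Rightarrow> 'a::comm_ring_1 poly \<Rightarrow> 'a mat" where
  "companion n f = mat n n (\<lambda>(i, j). if Suc j = n then - coeff f i else if i = Suc j then 1 else 0)"

text \<open>\<open>c k\<close> represents x^k v in the lattice, so it is A^k applied to
  \<open>c 0\<close>. The power \<open>n\<close>, one beyond the columns of \<open>P\<close>,
  determines the last column of the product.\<close>

lemma companion_intertwining:
  assumes A: "A \<in> carrier_mat n n"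
    and power: "\<And>i k. i < n \<Longrightarrow> k \<le> n \<Longrightarrow> monom 1 k * v i = char_op A (q k) i + [:c k i:]"
  defines "P \<equiv> mat n n (\<lambda>(i, j). c j i)"
  shows "A * P = P * companion n (char_poly A)"
proof (rule eq_matI)
  let ?f = "char_poly A"
  have f: "degree ?f = n" "coeff ?f n = 1"
    using degree_monic_char_poly[OF A] by simp_all
  \<comment> \<open>Two representations of x^(k+1) v, one of them obtained from x^k v through
    \<open>char_op_const\<close>, have the same constants.\<close>
  have step: "(\<Sum>j<n. A $$ (i, j) * c k j) = c (Suc k) i" if "i < n" "k < n" for i k
  proof -
    have "char_op A (\<lambda>j. q (Suc k) j - ([:0, 1:] * q k j + [:c k j:])) i
        = [:(\<Sum>j<n. A $$ (i, j) * c k j) - c (Suc k) i:]" if i: "i < n" for i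
    proof -
      have "monom 1 (Suc k) * v i = [:0, 1:] * (monom 1 k * v i)"
        by (simp add: monom_Suc)
      then have "char_op A (q (Suc k)) i + [:c (Suc k) i:] = [:0, 1:] * char_op A (q k) i + [:0, 1:] * [:c k i:]"
        using power[OF i, of k] power[OF i, of "Suc k"] \<open>k < n\<close> by (simp only: distrib_left)
      then have "char_op A (q (Suc k)) i
          = [:0, 1:] * char_op A (q k) i + char_op A (\<lambda>j. [:c k j:]) i
            + ([:\<Sum>j<n. A $$ (i, j) * c k j:] - [:c (Suc k) i:])"
        unfolding char_op_const[OF A i] by (simp only: algebra_simps)
      then show ?thesis
        unfolding char_op_diff char_op_add char_op_scale by simp
    qed
    from char_op_const_unique[OF A this \<open>i < n\<close>] show ?thesis
      by simp
  qed
  \<comment> \<open>Two representations of f v are compared: the adjugate gives constants 0, the sum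
    over the powers gives the combination of the \<open>c k\<close>.\<close>
  have last: "(\<Sum>k<n. c k i * coeff ?f k) = - c n i" if "i < n" for i
  proof -
    let ?u = "\<lambda>j. \<Sum>k<n. adj_mat (char_poly_matrix A) $$ (j, k) * v k"
    have "char_op A (\<lambda>j. ?u j - (\<Sum>k\<le>n. [:coeff ?f k:] * q k j)) i = [:\<Sum>k\<le>n. coeff ?f k * c k i:]"
      if i: "i < n" for i
    proof -
      have "?f = (\<Sum>k\<le>n. [:coeff ?f k:] * monom 1 k)"
        using poly_as_sum_of_monoms[of ?f] by (simp add: f(1) smult_monom)
      then have "?f * v i = (\<Sum>k\<le>n. [:coeff ?f k:] * monom 1 k) * v i"
        by simp
      also have "\<dots> = (\<Sum>k\<le>n. [:coeff ?f k:] * (monom 1 k * v i))"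
        by (simp only: sum_distrib_right mult.assoc)
      also have "\<dots> = (\<Sum>k\<le>n. [:coeff ?f k:] * char_op A (q k) i + [:coeff ?f k:] * [:c k i:])"
        using power[OF i] by (intro sum.cong) (simp_all only: distrib_left atMost_iff)
      also have "\<dots> = (\<Sum>k\<le>n. [:coeff ?f k:] * char_op A (q k) i) + [:\<Sum>k\<le>n. coeff ?f k * c k i:]"
        by (simp add: sum.distrib sum_to_poly[symmetric] mult.commute)
      finally show ?thesis
        unfolding char_op_diff char_op_adj_mat[OF A i] by (simp only: char_op_sum char_op_scale add_diff_cancel_left')
    qed
    from char_op_const_unique[OF A this \<open>i < n\<close>] have "(\<Sum>k\<le>n. coeff ?f k * c k i) = 0" .
    then show ?thesis
      using f(2) by (simp add: lessThan_Suc_atMost[symmetric] mult.commute add_eq_0_iff)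
  qed
  fix i j
  assume "i < dim_row (P * companion n ?f)" and "j < dim_col (P * companion n ?f)"
  then have ij: "i < n" "j < n"
    by (simp_all add: P_def companion_def)
  have "(A * P) $$ (i, j) = c (Suc j) i"
    using A ij step[OF ij] by (simp add: P_def scalar_prod_def lessThan_atLeast0)
  also have "\<dots> = (\<Sum>k<n. c k i * companion n ?f $$ (k, j))"
  proof (cases "Suc j = n")
    case True
    then show ?thesis
      using last[OF ij(1)] ij by (simp add: companion_def sum_negf)
  next
    case False
    then have "(\<Sum>k<n. c k i * companion n ?f $$ (k, j)) = (\<Sum>k<n. if k = Suc j then c k i else 0)"
      using ij by (intro sum.cong) (auto simp: companion_def)
    then show ?thesis
      using False ij by simp
  qed
  also have "\<dots> = (P * companion n ?f) $$ (i, j)"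
    using ij by (simp add: P_def companion_def scalar_prod_def lessThan_atLeast0)
  finally show "(A * P) $$ (i, j) = (P * companion n ?f) $$ (i, j)" .
qed (use A in \<open>simp_all add: P_def companion_def\<close>)

lemma module_fun_mult: "Modules.module (\<lambda>(g::'a::comm_ring_1) (w::'b \<Rightarrow> 'a) i. g * w i)"
  by unfold_locales (auto simp: fun_eq_iff algebra_simps)

text \<open>The abstract generator lemma is applied to vectors of integer polynomials. The columns
  of \<open>P\<close> are the constants representing x^k v for the generator
  \<open>v\<close>.\<close>

lemma ex_cyclic_mod_prime:
  fixes A :: "int mat"
  assumes A: "A \<in> carrier_mat n n" and p: "prime p"
    and bezout: "a * char_poly A + b * pderiv (char_poly A) = [:r:]" "\<not> int p dvd r"
  shows "\<exists>P \<in> carrier_mat n n. \<not> int p dvd det P \<and> A * P = P * companion n (char_poly A)"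
proof -
  let ?f = "char_poly A" and ?M = "char_poly_matrix A"
  have f: "degree ?f = n" "lead_coeff ?f = 1"
    using degree_monic_char_poly[OF A] by simp_all
  have M: "?M \<in> carrier_mat n n"
    using A by simp
  define scale where "scale = (\<lambda>(g::int poly) (w::nat \<Rightarrow> int poly) i. g * w i)"
  \<comment> \<open>The quotient by N is the reduction of the lattice modulo p, with x acting as A.\<close>
  define N where "N = {w. \<exists>q s. \<forall>i<n. w i = char_op A q i + [:int p:] * s i}"
  have N_I: "w \<in> N" if "\<And>i. i < n \<Longrightarrow> w i = char_op A q i + [:int p:] * s i" for w q s
    unfolding N_def using that by (intro CollectI exI allI impI)
  have N_E: "\<exists>q s. \<forall>i<n. w i = char_op A q i + [:int p:] * s i" if "w \<in> N" for w
    using that unfolding N_def by (rule CollectD)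
  interpret Modules.module scale
    unfolding scale_def by (rule module_fun_mult)
  have "subspace N"
  proof (rule subspaceI)
    show "0 \<in> N"
      by (rule N_I[of _ "\<lambda>j. 0" "\<lambda>j. 0"]) simp
  next
    fix v w assume "v \<in> N" "w \<in> N"
    then obtain q s q' s' where "\<forall>i<n. v i = char_op A q i + [:int p:] * s i"
      "\<forall>i<n. w i = char_op A q' i + [:int p:] * s' i"
      using N_E by metis
    then show "v + w \<in> N"
      by (intro N_I[of _ "\<lambda>j. q j + q' j" "\<lambda>j. s j + s' j"])
        (simp add: char_op_add smult_add_right)
  next
    fix g v assume "v \<in> N"
    then obtain q s where "\<forall>i<n. v i = char_op A q i + [:int p:] * s i"
      using N_E by metis
    then show "scale g v \<in> N"
      by (intro N_I[of _ "\<lambda>j. g * q j" "\<lambda>j. g * s j"])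
        (simp add: scale_def char_op_scale distrib_left)
  qed
  moreover have "scale [:int p:] v \<in> N" for v
    by (rule N_I[of _ "\<lambda>j. 0" v]) (simp add: scale_def)
  moreover have "scale ?f v \<in> N" for v
    by (rule N_I[of _ "\<lambda>j. \<Sum>k<n. adj_mat ?M $$ (j, k) * v k" "\<lambda>j. 0"])
      (simp add: scale_def char_op_adj_mat[OF A])
  moreover have "\<exists>k z. [:int p:] dvd m ^ k - ?f * z" if m: "\<And>w. scale m w \<in> N" for m
  proof -
    \<comment> \<open>Applied to the unit vectors, the hypothesis yields the columns of a
      \<open>Q\<close> with \<open>?M * Q\<close> equal to \<open>m\<close> times the identity
      modulo \<open>p\<close>; determinants give the exponent \<open>n\<close> and
      \<open>z = det Q\<close>.\<close>
    have "\<exists>q s. \<forall>i<n. m * (if i = l then 1 else 0) = char_op A q i + [:int p:] * s i" for l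
      using N_E[OF m[of "\<lambda>i. if i = l then 1 else 0"]] unfolding scale_def .
    then obtain q s where qs: "\<And>l i. i < n \<Longrightarrow>
        m * (if i = l then 1 else 0) = char_op A (q l) i + [:int p:] * s l i"
      by metis
    define Q where "Q = mat n n (\<lambda>(j, l). q l j)"
    have Q: "Q \<in> carrier_mat n n"
      by (simp add: Q_def)
    have "[:int p:] dvd (m \<cdot>\<^sub>m 1\<^sub>m n) $$ (i, l) - (?M * Q) $$ (i, l)" if "i < n" "l < n" for i l
    proof -
      have "(?M * Q) $$ (i, l) = char_op A (q l) i"
        using carrier_matD[OF M] carrier_matD[OF A] that
        by (simp add: Q_def char_op_def scalar_prod_def lessThan_atLeast0)
      then have "(m \<cdot>\<^sub>m 1\<^sub>m n) $$ (i, l) - (?M * Q) $$ (i, l) = [:int p:] * s l i"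
        using qs[OF that(1), of l] that by simp
      then show ?thesis
        by (simp only: dvd_triv_left)
    qed
    then have "[:int p:] dvd det (m \<cdot>\<^sub>m 1\<^sub>m n) - det (?M * Q)"
      using M Q by (intro dvd_det_diff[of _ n]) auto
    then have "[:int p:] dvd m ^ n - ?f * det Q"
      using M Q by (simp add: det_mult char_poly_def)
    then show ?thesis
      by blast
  qed
  ultimately obtain v where v: "\<And>g. lead_coeff g = 1 \<Longrightarrow> scale g v \<in> N \<Longrightarrow> n \<le> degree g"
    using ex_generator_mod_prime[OF module_axioms _ p f(2) _ _ bezout] f(1) by metis
  have "\<exists>q c. \<forall>i<n. monom 1 k * v i = char_op A q i + [:c i:]" for k
    by (rule ex_const_mod_char_op[OF A])
  then obtain q c where qc: "\<And>k i. i < n \<Longrightarrow> monom 1 k * v i = char_op A (q k) i + [:c k i:]"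
    by metis
  define P where "P = mat n n (\<lambda>(i, j). c j i)"
  have "A * P = P * companion n ?f"
    unfolding P_def using A qc by (intro companion_intertwining[where v = v and q = q]) auto
  moreover have P: "P \<in> carrier_mat n n"
    by (simp add: P_def)
  moreover have "\<not> int p dvd det P"
  proof (rule prime_not_dvd_det[OF p P])
    fix d j
    assume ker: "\<And>i. i < n \<Longrightarrow> int p dvd (\<Sum>k<n. P $$ (i, k) * d k)" and j: "j < n"
    \<comment> \<open>A kernel vector of \<open>P\<close> modulo \<open>p\<close> is the coefficient
      vector of a polynomial of degree below \<open>n\<close> killing the generator, so it must
      vanish modulo \<open>p\<close>.\<close>
    define g where "g = (\<Sum>k<n. monom (d k) k)"
    have coeff_g: "coeff g k = (if k < n then d k else 0)" for k
      by (simp add: g_def coeff_sum)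
    have "\<exists>s. (\<Sum>k<n. c k i * d k) = int p * s" if "i < n" for i
      using ker[OF that] that by (simp add: P_def dvd_def)
    then obtain s where s: "\<And>i. i < n \<Longrightarrow> (\<Sum>k<n. c k i * d k) = int p * s i"
      by metis
    have "scale g v \<in> N"
    proof (rule N_I[of _ "\<lambda>j. \<Sum>k<n. [:d k:] * q k j" "\<lambda>i. [:s i:]"])
      fix i assume i: "i < n"
      have "scale g v i = (\<Sum>k<n. [:d k:] * (monom 1 k * v i))"
        by (simp add: scale_def g_def sum_distrib_right smult_monom flip: mult.assoc)
      also have "\<dots> = (\<Sum>k<n. [:d k:] * char_op A (q k) i) + [:\<Sum>k<n. c k i * d k:]"
        using qc[OF i] by (simp add: sum.distrib smult_add_right mult.commute flip: sum_to_poly)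
      finally show "scale g v i = char_op A (\<lambda>j. \<Sum>k<n. [:d k:] * q k j) i + [:int p:] * [:s i:]"
        unfolding char_op_sum char_op_scale s[OF i] by simp
    qed
    have "[:int p:] dvd g"
    proof (rule ccontr)
      assume *: "\<not> [:int p:] dvd g"
      then obtain e h where h: "lead_coeff h = 1" "degree h \<le> degree g"
        "[:int p:] dvd Polynomial.smult e g - h"
        using monic_multiple_mod_prime[OF p] by metis
      obtain t where t: "Polynomial.smult e g - h = [:int p:] * t"
        using h(3) by (rule dvdE)
      have "scale h v = scale [:e:] (scale g v) - scale [:int p:] (scale t v)"
        unfolding scale_def fun_eq_iff minus_apply
        using arg_cong[OF t, of "\<lambda>u. u * v _"] by (simp add: algebra_simps)
      then have "scale h v \<in> N"
        using subspace_diff[OF \<open>subspace N\<close>] subspace_scale[OF \<open>subspace N\<close> \<open>scale g v \<in> N\<close>]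
          \<open>\<And>v. scale [:int p:] v \<in> N\<close> by metis
      then have "n \<le> degree g"
        using v h(1,2) le_trans by blast
      \<comment> \<open>A non-zero \<open>g\<close> has a non-zero leading coefficient, whereas its
        coefficients from index \<open>n\<close> on vanish.\<close>
      moreover have "g \<noteq> 0"
        using * by auto
      ultimately show False
        using coeff_g[of "degree g"] by simp
    qed
    then have "int p dvd coeff g j"
      unfolding const_poly_dvd_iff by blast
    then show "int p dvd d j"
      using j by (simp add: coeff_g)
  qed
  ultimately show ?thesis
    by blast
qed

text \<open>One companion matrix is intertwined with both \<open>A\<close> and \<open>B\<close>;
  using the adjugate of \<open>Q\<close> for its inverse keeps the entries integral.\<close>

lemma ex_intertwining_coprime_det:
  fixes A B :: "int mat"
  assumes A: "A \<in> carrier_mat n n" and B: "B \<in> carrier_mat n n" and p: "prime p"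
    and eq: "char_poly A = char_poly B"
    and bezout: "a * char_poly A + b * pderiv (char_poly A) = [:r:]" "\<not> int p dvd r"
  shows "\<exists>X \<in> carrier_mat n n. A * X = X * B \<and> \<not> int p dvd det X"
proof -
  define C where "C = companion n (char_poly A)"
  have C: "C \<in> carrier_mat n n"
    by (simp add: C_def companion_def)
  obtain P where P: "P \<in> carrier_mat n n" "\<not> int p dvd det P" "A * P = P * C"
    using ex_cyclic_mod_prime[OF A p bezout] unfolding C_def by blast
  obtain Q where Q: "Q \<in> carrier_mat n n" "\<not> int p dvd det Q" "B * Q = Q * C"
    using ex_cyclic_mod_prime[OF B p bezout[unfolded eq]] unfolding C_def eq by blast
  let ?Q = "adj_mat Q"
  note adj = adj_mat[OF Q(1)]
  have "det Q \<noteq> 0"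
    using Q(2) by auto
  \<comment> \<open>Multiplying \<open>B * Q = Q * C\<close> by the adjugate on both sides leaves a
    factor \<open>det Q\<close>, which is cancelled entrywise below.\<close>
  have "det Q \<cdot>\<^sub>m (C * ?Q) = (?Q * Q) * (C * ?Q)"
    unfolding adj(3) using C adj(1) by (simp add: mult_smult_assoc_mat[of _ n n _ n])
  also have "\<dots> = ?Q * ((Q * C) * ?Q)"
    using C Q(1) adj(1) by (simp add: assoc_mult_mat[of _ n n _ n _ n])
  also have "\<dots> = ?Q * B * (Q * ?Q)"
    unfolding Q(3)[symmetric] using B Q(1) adj(1) by (simp add: assoc_mult_mat[of _ n n _ n _ n])
  also have "\<dots> = det Q \<cdot>\<^sub>m (?Q * B)"
    using B adj(1) by (simp add: adj(2) mult_smult_distrib[of _ n n _ n] right_mult_one_mat[of _ n n])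
  finally have scaled: "det Q \<cdot>\<^sub>m (C * ?Q) = det Q \<cdot>\<^sub>m (?Q * B)" .
  have CQ: "C * ?Q = ?Q * B"
  proof (rule eq_matI)
    fix i j assume "i < dim_row (?Q * B)" "j < dim_col (?Q * B)"
    then have "i < n" "j < n"
      using adj(1) B by auto
    then show "(C * ?Q) $$ (i, j) = (?Q * B) $$ (i, j)"
      using arg_cong[OF scaled, of "\<lambda>M. M $$ (i, j)"] C B adj(1) \<open>det Q \<noteq> 0\<close> by simp
  qed (use C B adj(1) in auto)
  have "A * (P * ?Q) = P * (C * ?Q)"
    using assoc_mult_mat[OF A P(1) adj(1)] assoc_mult_mat[OF P(1) C adj(1)] P(3) by simp
  also have "\<dots> = P * ?Q * B"
    unfolding CQ by (rule assoc_mult_mat[OF P(1) adj(1) B, symmetric])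
  finally have "A * (P * ?Q) = P * ?Q * B" .
  moreover have "\<not> int p dvd det (P * ?Q)"
  proof -
    \<comment> \<open>The determinant of the adjugate divides a power of \<open>det Q\<close>, so it
      is also prime to \<open>p\<close>.\<close>
    have "det Q * det ?Q = det Q ^ n"
      using arg_cong[OF adj(2), of det] Q(1) adj(1) by (simp add: det_mult)
    moreover have "\<not> int p dvd det Q ^ n"
      using Q(2) p prime_dvd_power[of "int p"] by auto
    ultimately have "\<not> int p dvd det ?Q"
      by (metis dvd_mult)
    then show ?thesis
      using P p adj(1) prime_dvd_mult_iff[of "int p"] by (simp add: det_mult[of _ n])
  qed
  moreover have "P * ?Q \<in> carrier_mat n n"
    using P(1) adj(1) by simp
  ultimately show ?thesis
    by blast
qed

section \<open>Conjugacy over the p-adic integers\<close>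

text \<open>Its additive form gives the exchange of sums behind associativity of the matrix
  product.\<close>

lemma (in comm_monoid) finprod_swap:
  assumes "finite A" "finite B" "\<And>i j. i \<in> A \<Longrightarrow> j \<in> B \<Longrightarrow> g i j \<in> carrier G"
  shows "(\<Otimes>i\<in>A. \<Otimes>j\<in>B. g i j) = (\<Otimes>j\<in>B. \<Otimes>i\<in>A. g i j)"
  using assms(1,3)
proof (induction A rule: finite_induct)
  case empty
  then show ?case
    by (simp add: finprod_one_eqI)
next
  case (insert a A)
  have "(\<Otimes>i\<in>insert a A. \<Otimes>j\<in>B. g i j) = (\<Otimes>j\<in>B. g a j) \<otimes> (\<Otimes>i\<in>A. \<Otimes>j\<in>B. g i j)"
    using insert by (intro finprod_insert) auto
  also have "\<dots> = (\<Otimes>j\<in>B. g a j) \<otimes> (\<Otimes>j\<in>B. \<Otimes>i\<in>A. g i j)"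
    using insert by simp
  also have "\<dots> = (\<Otimes>j\<in>B. g a j \<otimes> (\<Otimes>i\<in>A. g i j))"
    using insert.prems by (intro finprod_multf[symmetric]) auto
  also have "\<dots> = (\<Otimes>j\<in>B. \<Otimes>i\<in>insert a A. g i j)"
    using insert by (intro finprod_cong' refl finprod_insert[symmetric]) auto
  finally show ?case .
qed

section \<open>Matrix monoids over a commutative ring\<close>

context cring
begin

lemmas finsum_swap = add.finprod_swap[folded finsum_def]

lemma mat_monoid: "monoid (mat_monoid R n)"
proof (rule monoidI)
  fix X Y Z
  assume X: "X \<in> carrier (mat_monoid R n)" and Y: "Y \<in> carrier (mat_monoid R n)"
    and Z: "Z \<in> carrier (mat_monoid R n)"
  have [simp]: "X $$ (i, j) \<in> carrier R" "Y $$ (i, j) \<in> carrier R" "Z $$ (i, j) \<in> carrier R"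
    if "i < n" "j < n" for i j
    using X Y Z that by (simp_all add: mat_monoid_def)
  show "X \<otimes>\<^bsub>mat_monoid R n\<^esub> Y \<in> carrier (mat_monoid R n)"
    by (auto simp: mat_monoid_def intro!: finsum_closed)
  have "(\<Oplus>k\<in>{0..<n}. (\<Oplus>l\<in>{0..<n}. X $$ (i, l) \<otimes> Y $$ (l, k)) \<otimes> Z $$ (k, j))
      = (\<Oplus>l\<in>{0..<n}. X $$ (i, l) \<otimes> (\<Oplus>k\<in>{0..<n}. Y $$ (l, k) \<otimes> Z $$ (k, j)))"
    if ij: "i < n" "j < n" for i j
  proof -
    have "(\<Oplus>k\<in>{0..<n}. (\<Oplus>l\<in>{0..<n}. X $$ (i, l) \<otimes> Y $$ (l, k)) \<otimes> Z $$ (k, j))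
        = (\<Oplus>k\<in>{0..<n}. \<Oplus>l\<in>{0..<n}. X $$ (i, l) \<otimes> (Y $$ (l, k) \<otimes> Z $$ (k, j)))"
      using ij by (intro finsum_cong' refl) (auto simp: finsum_ldistr m_assoc intro!: finsum_closed finsum_cong')
    also have "\<dots> = (\<Oplus>l\<in>{0..<n}. \<Oplus>k\<in>{0..<n}. X $$ (i, l) \<otimes> (Y $$ (l, k) \<otimes> Z $$ (k, j)))"
      using ij by (intro finsum_swap) auto
    also have "\<dots> = (\<Oplus>l\<in>{0..<n}. X $$ (i, l) \<otimes> (\<Oplus>k\<in>{0..<n}. Y $$ (l, k) \<otimes> Z $$ (k, j)))"
      using ij by (intro finsum_cong' refl) (auto simp: finsum_rdistr intro!: finsum_closed)
    finally show ?thesis .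
  qed
  then show "X \<otimes>\<^bsub>mat_monoid R n\<^esub> Y \<otimes>\<^bsub>mat_monoid R n\<^esub> Z = X \<otimes>\<^bsub>mat_monoid R n\<^esub> (Y \<otimes>\<^bsub>mat_monoid R n\<^esub> Z)"
    unfolding mat_monoid_def by (intro eq_matI) (auto cong: finsum_cong)
next
  show "\<one>\<^bsub>mat_monoid R n\<^esub> \<in> carrier (mat_monoid R n)"
    by (simp add: mat_monoid_def)
next
  fix X
  assume X: "X \<in> carrier (mat_monoid R n)"
  then have [simp]: "X $$ (i, j) \<in> carrier R" if "i < n" "j < n" for i j
    using that by (simp add: mat_monoid_def)
  have "(\<Oplus>k\<in>{0..<n}. (if i = k then \<one> else \<zero>) \<otimes> X $$ (k, j)) = X $$ (i, j)"
    "(\<Oplus>k\<in>{0..<n}. X $$ (i, k) \<otimes> (if k = j then \<one> else \<zero>)) = X $$ (i, j)"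
    if ij: "i < n" "j < n" for i j
  proof -
    have "(\<Oplus>k\<in>{0..<n}. (if i = k then \<one> else \<zero>) \<otimes> X $$ (k, j))
        = (\<Oplus>k\<in>{0..<n}. if i = k then X $$ (k, j) else \<zero>)"
      using ij by (intro finsum_cong') auto
    then show "(\<Oplus>k\<in>{0..<n}. (if i = k then \<one> else \<zero>) \<otimes> X $$ (k, j)) = X $$ (i, j)"
      using ij by (simp add: add.finprod_singleton)
    have "(\<Oplus>k\<in>{0..<n}. X $$ (i, k) \<otimes> (if k = j then \<one> else \<zero>))
        = (\<Oplus>k\<in>{0..<n}. if j = k then X $$ (i, k) else \<zero>)"
      using ij by (intro finsum_cong') auto
    then show "(\<Oplus>k\<in>{0..<n}. X $$ (i, k) \<otimes> (if k = j then \<one> else \<zero>)) = X $$ (i, j)"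
      using ij by (simp add: add.finprod_singleton)
  qed
  then show "\<one>\<^bsub>mat_monoid R n\<^esub> \<otimes>\<^bsub>mat_monoid R n\<^esub> X = X" "X \<otimes>\<^bsub>mat_monoid R n\<^esub> \<one>\<^bsub>mat_monoid R n\<^esub> = X"
    using X unfolding mat_monoid_def by (auto intro!: eq_matI cong: finsum_cong)
qed

end

text \<open>An inverse exists modulo every power of \<open>p\<close>; uniqueness of inverses makes
  these residues a compatible sequence.\<close>

lemma padic_of_int_unit:
  assumes p: "prime p" and d: "\<not> int p dvd d"
  shows "padic_of_int p d \<in> Units (padic_int p)"
proof -
  have "p > 0"
    using p by (simp add: prime_gt_0_nat)
  have cop: "coprime d (int p ^ k)" for k
    using p d prime_imp_coprime[of "int p" d] by (simp add: ac_simps)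
  then have "\<exists>e. [d * e = 1] (mod int p ^ k)" for k
    using cong_solve_coprime_int by blast
  then obtain e where e: "\<And>k. [d * e k = 1] (mod int p ^ k)"
    by metis
  \<comment> \<open>The carrier requires least non-negative representatives.\<close>
  define x where "x = (\<lambda>k. e k mod int p ^ k)"
  have x: "[d * x k = 1] (mod int p ^ k)" for k
    using e[of k] by (simp add: x_def cong_def mod_mult_right_eq)
  have "x (Suc k) mod int p ^ k = x k" for k
  proof -
    have "[d * x (Suc k) = 1] (mod int p ^ k)"
      using x[of "Suc k"] by (rule cong_dvd_modulus) simp
    then have "[d * x (Suc k) = d * x k] (mod int p ^ k)"
      using x[of k] by (metis cong_sym cong_trans)
    then have "[x (Suc k) = x k] (mod int p ^ k)"
      using cop[of k] by (simp add: cong_mult_lcancel)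
    then show ?thesis
      by (simp add: cong_def x_def)
  qed
  then have closed: "x \<in> carrier (padic_int p)"
    using \<open>p > 0\<close> by (simp add: padic_int_def) (simp add: x_def)
  interpret cring "padic_int p"
    using \<open>p > 0\<close> by (rule padic_int_cring)
  have "padic_of_int p d \<otimes>\<^bsub>padic_int p\<^esub> x = \<one>\<^bsub>padic_int p\<^esub>"
    using x by (simp add: padic_int_def padic_of_int_def cong_def mod_mult_left_eq)
  then show ?thesis
    using closed padic_of_int_closed[OF \<open>p > 0\<close>, of d] m_comm by (auto simp: Units_def)
qed

section \<open>Transport along a homomorphism from the integers\<close>

context
  fixes R :: "('a, 'b) ring_scheme" (structure) and h :: "int \<Rightarrow> 'a"
  assumes R: "cring R" and h: "h \<in> Ring.ring_hom \<Z> R"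
begin

interpretation cring R
  by (rule R)

interpretation h: ring_hom_cring \<Z> R h
  by (intro ring_hom_cring.intro ring_hom_cring_axioms.intro int_is_cring R h)

lemma map_mat_carrier_mat_monoid: "X \<in> carrier_mat n n \<Longrightarrow> map_mat h X \<in> carrier (mat_monoid R n)"
  using h.hom_closed by (simp add: mat_monoid_def)

lemma map_mat_mult_mat_monoid:
  assumes "X \<in> carrier_mat n n" "Y \<in> carrier_mat n n"
  shows "map_mat h (X * Y) = map_mat h X \<otimes>\<^bsub>mat_monoid R n\<^esub> map_mat h Y"
proof (rule eq_matI)
  fix i j
  assume "i < dim_row (map_mat h X \<otimes>\<^bsub>mat_monoid R n\<^esub> map_mat h Y)"
    and "j < dim_col (map_mat h X \<otimes>\<^bsub>mat_monoid R n\<^esub> map_mat h Y)"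
  then have ij: "i < n" "j < n"
    by (simp_all add: mat_monoid_def)
  have "map_mat h (X * Y) $$ (i, j) = h (\<Sum>k = 0..<n. X $$ (i, k) * Y $$ (k, j))"
    using assms ij by (simp add: scalar_prod_def)
  also have "\<dots> = (\<Oplus>k\<in>{0..<n}. h (X $$ (i, k)) \<otimes> h (Y $$ (k, j)))"
    using h.hom_finsum[of "\<lambda>k. X $$ (i, k) * Y $$ (k, j)" "{0..<n}"]
    by (simp add: comp_def h.hom_mult[simplified])
  also have "\<dots> = (map_mat h X \<otimes>\<^bsub>mat_monoid R n\<^esub> map_mat h Y) $$ (i, j)"
    using assms ij h.hom_closed by (simp add: mat_monoid_def) (intro finsum_cong'; simp)
  finally show "map_mat h (X * Y) $$ (i, j) = (map_mat h X \<otimes>\<^bsub>mat_monoid R n\<^esub> map_mat h Y) $$ (i, j)" .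
qed (use assms in \<open>simp_all add: mat_monoid_def\<close>)

lemma ring_det_map_mat:
  assumes "X \<in> carrier_mat n n"
  shows "ring_det R n (map_mat h X) = h (det X)"
proof -
  have sign: "h (signof \<pi>) = (if evenperm \<pi> then \<one> else \<ominus> \<one>)" for \<pi> :: "nat \<Rightarrow> nat"
    using h.hom_one h.hom_a_inv[of 1] by (simp add: sign_def int_a_inv_eq)
  have prod: "h (\<Prod>i = 0..<n. X $$ (i, \<pi> i)) = (\<Otimes>i\<in>{0..<n}. map_mat h X $$ (i, \<pi> i))"
    if "\<pi> permutes {0..<n}" for \<pi>
    using h.hom_finprod[of "\<lambda>i. X $$ (i, \<pi> i)" "{0..<n}"] assms permutes_in_image[OF that] h.hom_closed
    by (simp add: comp_def) (intro finprod_cong'; simp)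
  have "h (det X) = (\<Oplus>\<pi>\<in>{\<pi>. \<pi> permutes {0..<n}}. h (signof \<pi> * (\<Prod>i = 0..<n. X $$ (i, \<pi> i))))"
    unfolding det_def'[OF assms]
    using h.hom_finsum[of "\<lambda>\<pi>. signof \<pi> * (\<Prod>i = 0..<n. X $$ (i, \<pi> i))" "{\<pi>. \<pi> permutes {0..<n}}"]
    by (simp add: comp_def)
  also have "\<dots> = ring_det R n (map_mat h X)"
    unfolding ring_det_def
  proof (intro finsum_cong' refl)
    fix \<pi> :: "nat \<Rightarrow> nat"
    assume "\<pi> \<in> {\<pi>. \<pi> permutes {0..<n}}"
    then show "h (signof \<pi> * (\<Prod>i = 0..<n. X $$ (i, \<pi> i)))
        = (if evenperm \<pi> then \<one> else \<ominus> \<one>) \<otimes> (\<Otimes>i\<in>{0..<n}. map_mat h X $$ (i, \<pi> i))"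
      using h.hom_mult by (simp add: prod flip: sign)
  next
    show "(\<lambda>\<pi>. (if evenperm \<pi> then \<one> else \<ominus> \<one>) \<otimes> (\<Otimes>i\<in>{0..<n}. map_mat h X $$ (i, \<pi> i)))
        \<in> {\<pi>. \<pi> permutes {0..<n}} \<rightarrow> carrier R"
      using assms h.hom_closed permutes_in_image[of _ "{0..<n}"] by (fastforce intro!: finprod_closed)
  qed
  finally show ?thesis ..
qed

text \<open>Cramer's rule survives the transport: once the image of \<open>det X\<close> is a unit,
  the image of \<open>X\<close> is invertible, and the intertwining relation becomes
  conjugation.\<close>

lemma GL_conjugate_of_intertwining:
  assumes A: "A \<in> carrier_mat n n" and B: "B \<in> carrier_mat n n" and X: "X \<in> carrier_mat n n"
    and AX: "A * X = X * B" and det: "h (det X) \<in> Units R"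
  shows "GL_conjugate R n (map_mat h A) (map_mat h B)"
proof -
  let ?M = "mat_monoid R n"
  let ?h = "map_mat h"
  interpret M: monoid ?M
    by (rule mat_monoid)
  note closed = map_mat_carrier_mat_monoid
  define e where "e = inv (h (det X))"
  have e: "e \<in> carrier R" "h (det X) \<otimes> e = \<one>"
    using det by (simp_all add: e_def)
  have adj: "adj_mat X \<in> carrier_mat n n" "X * adj_mat X = det X \<cdot>\<^sub>m 1\<^sub>m n" "adj_mat X * X = det X \<cdot>\<^sub>m 1\<^sub>m n"
    using adj_mat[OF X] by simp_all
  \<comment> \<open>The inverse of the image of \<open>X\<close>: the image of the adjugate divided
    by that of the determinant.\<close>
  define Y where "Y = map_mat (\<lambda>x. e \<otimes> x) (?h (adj_mat X))"
  have Y: "Y \<in> carrier ?M"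
    using adj(1) e(1) h.hom_closed by (simp add: Y_def mat_monoid_def)
  have hX [simp]: "i < n \<Longrightarrow> j < n \<Longrightarrow> h (X $$ (i, j)) \<in> carrier R"
      "i < n \<Longrightarrow> j < n \<Longrightarrow> h (adj_mat X $$ (i, j)) \<in> carrier R" for i j
    using h.hom_closed by simp_all
  have scaled_one: "e \<otimes> (?h (det X \<cdot>\<^sub>m 1\<^sub>m n)) $$ (i, j) = \<one>\<^bsub>?M\<^esub> $$ (i, j)" if "i < n" "j < n" for i j
    using that e h.hom_zero by (simp add: mat_monoid_def m_comm)
  have "?h X \<otimes>\<^bsub>?M\<^esub> Y = \<one>\<^bsub>?M\<^esub>"
  proof (rule eq_matI)
    fix i j
    assume "i < dim_row \<one>\<^bsub>?M\<^esub>" "j < dim_col \<one>\<^bsub>?M\<^esub>"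
    then have ij: "i < n" "j < n"
      by (simp_all add: mat_monoid_def)
    have "(?h X \<otimes>\<^bsub>?M\<^esub> Y) $$ (i, j) = (\<Oplus>k\<in>{0..<n}. e \<otimes> (h (X $$ (i, k)) \<otimes> h (adj_mat X $$ (k, j))))"
      using ij X adj(1) e(1) by (simp add: mat_monoid_def Y_def) (intro finsum_cong'; simp add: m_lcomm)
    also have "\<dots> = e \<otimes> (?h X \<otimes>\<^bsub>?M\<^esub> ?h (adj_mat X)) $$ (i, j)"
      using ij X adj(1) e(1)
      by (simp add: mat_monoid_def finsum_rdistr Pi_def) (intro finsum_cong'; simp)
    also have "\<dots> = \<one>\<^bsub>?M\<^esub> $$ (i, j)"
      using scaled_one[OF ij] by (simp add: adj(2) flip: map_mat_mult_mat_monoid[OF X adj(1)])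
    finally show "(?h X \<otimes>\<^bsub>?M\<^esub> Y) $$ (i, j) = \<one>\<^bsub>?M\<^esub> $$ (i, j)" .
  qed (simp_all add: mat_monoid_def)
  moreover have "Y \<otimes>\<^bsub>?M\<^esub> ?h X = \<one>\<^bsub>?M\<^esub>"
  proof (rule eq_matI)
    fix i j
    assume "i < dim_row \<one>\<^bsub>?M\<^esub>" "j < dim_col \<one>\<^bsub>?M\<^esub>"
    then have ij: "i < n" "j < n"
      by (simp_all add: mat_monoid_def)
    have "(Y \<otimes>\<^bsub>?M\<^esub> ?h X) $$ (i, j) = (\<Oplus>k\<in>{0..<n}. e \<otimes> (h (adj_mat X $$ (i, k)) \<otimes> h (X $$ (k, j))))"
      using ij X adj(1) e(1) by (simp add: mat_monoid_def Y_def) (intro finsum_cong'; simp add: m_assoc)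
    also have "\<dots> = e \<otimes> (?h (adj_mat X) \<otimes>\<^bsub>?M\<^esub> ?h X) $$ (i, j)"
      using ij X adj(1) e(1)
      by (simp add: mat_monoid_def finsum_rdistr Pi_def) (intro finsum_cong'; simp)
    also have "\<dots> = \<one>\<^bsub>?M\<^esub> $$ (i, j)"
      using scaled_one[OF ij] by (simp add: adj(3) flip: map_mat_mult_mat_monoid[OF adj(1) X])
    finally show "(Y \<otimes>\<^bsub>?M\<^esub> ?h X) $$ (i, j) = \<one>\<^bsub>?M\<^esub> $$ (i, j)" .
  qed (simp_all add: mat_monoid_def)
  ultimately have unit: "?h X \<in> Units ?M"
    using Y closed[OF X] by (auto simp: Units_def)
  have "inv\<^bsub>?M\<^esub> ?h X \<otimes>\<^bsub>?M\<^esub> ?h A \<otimes>\<^bsub>?M\<^esub> ?h X = inv\<^bsub>?M\<^esub> ?h X \<otimes>\<^bsub>?M\<^esub> (?h X \<otimes>\<^bsub>?M\<^esub> ?h B)"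
    using unit closed A B X by (simp add: M.m_assoc AX flip: map_mat_mult_mat_monoid)
  also have "\<dots> = ?h B"
    using unit closed[OF B] closed[OF X] by (simp flip: M.m_assoc)
  finally show ?thesis
    using det closed[OF X] by (auto simp: GL_conjugate_def GL_def ring_det_map_mat[OF X])
qed

end

theorem theorem1p2:
  fixes f :: "int poly" and n p :: nat and A B :: "int mat"
  assumes "squarefree f" and "degree f = n"
    and "A \<in> M_set f" and "B \<in> M_set f"
    and "prime p" and "\<not> int p dvd disc f"
  shows "GL_conjugate (padic_int p) n (map_mat (padic_of_int p) A) (map_mat (padic_of_int p) B)"
proof -
  have A: "A \<in> carrier_mat n n" "char_poly A = f" and B: "B \<in> carrier_mat n n" "char_poly B = f"
    using assms(2-4) by (auto simp: M_set_def)
  have "p > 0"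
    using assms(5) by (simp add: prime_gt_0_nat)
  have "lead_coeff f = 1"
    using degree_monic_char_poly[OF A(1)] A(2) assms(2) by simp
  \<comment> \<open>For monic \<open>f\<close> the discriminant is the resultant up to sign.\<close>
  then have res: "\<not> int p dvd resultant f (pderiv f)"
    using assms(6) by (auto simp: disc_def)
  have "\<exists>a b. a * f + b * pderiv f = [:resultant f (pderiv f):]"
  \<comment> \<open>\<open>resultant_bezout\<close> requires positive total degree; in degree 0 the
    monic \<open>f\<close> is 1 and the identity is immediate.\<close>
  proof (cases "degree f = 0")
    case True
    then have "f = 1"
      using \<open>lead_coeff f = 1\<close> by (simp add: monic_degree_0)
    then have "[:resultant f (pderiv f):] * f + 0 * pderiv f = [:resultant f (pderiv f):]"
      by simp
    then show ?thesis
      by blast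
  qed (intro resultant_bezout, simp)
  then obtain X where X: "X \<in> carrier_mat n n" "A * X = X * B" "\<not> int p dvd det X"
    using ex_intertwining_coprime_det[OF A(1) B(1) assms(5) _ _ res] A(2) B(2) by metis
  then show ?thesis
    using A(1) B(1) padic_of_int_unit[OF assms(5)]
    by (intro GL_conjugate_of_intertwining[of _ _ _ _ _ X] padic_int_cring padic_of_int_hom \<open>p > 0\<close>)
qed

end
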